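(* The randomized Riemannian gossip algorithm on $P_+(n)$ described in the context is invariant to the action of $GL(n)$ on $P_+(n)$ by congruence. That is: for any $G\in GL(n)$ and any initial values $W_{1,0},\dots,W_{m,0}\in P_+(n)$, if $W_{i,t}$ denotes the values produced by the algorithm from the initial values $W_{i,0}$, then the algorithm run with the initial values $GW_{1,0}G^T,\dots,GW_{m,0}G^T$ (and the same sequences of selected nodes and of step sizes) yields at every time $t$ and every node $i$ the matrix $GW_{i,t}G^T$.
   Context: $P_+(n)$ is the set of real symmetric positive definite $n\times n$ matrices, and $GL(n)$ (invertible real $n\times n$ matrices) acts on it by congruence, $W\mapsto GWG^T$. The algorithm: there are $m$ nodes labeled $1,\dots,m$, node $i$ holding at time $t$ a matrix $W_{i,t}\in P_+(n)$. At each time $t\ge0$ a node $i\in\{1,\dots,m-1\}$ is picked at random with probability $p_i>0$ ($\sum_{i=1}^{m-1}p_i=1$), and with step size $\gamma_t>0$ nodes $i$ and $i+1$ are updated by $$W_{i,t+1}=W_{i,t}^{1/2}\exp\bigl(\gamma_t\log(W_{i,t}^{-1/2}W_{i+1,t}W_{i,t}^{-1/2})\bigr)W_{i,t}^{1/2},$$ $$W_{i+1,t+1}=W_{i+1,t}^{1/2}\exp\bigl(\gamma_t\log(W_{i+1,t}^{-1/2}W_{i,t}W_{i+1,t}^{-1/2})\bigr)W_{i+1,t}^{1/2},$$ all other nodes keeping their values; $\exp$ and $\log$ are the matrix exponential and the (symmetric) matrix logarithm. *)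

theory Defs
  imports "HOL-Probability.Probability"
begin

definition pos_def_matrices :: "(real^'n^'n) set" where
  "pos_def_matrices = {W. transpose W = W \<and> (\<forall>x. x \<noteq> 0 \<longrightarrow> x \<bullet> (W *v x) > 0)}"

(* The library instance of times (hence of power) for vectors is componentwise, so powers and
   the exponential of square matrices are taken here with respect to the product **. *)
primrec matrix_power :: "real^'n^'n \<Rightarrow> nat \<Rightarrow> real^'n^'n" where
  "matrix_power A 0 = mat 1"
| "matrix_power A (Suc k) = A ** matrix_power A k"

definition matrix_exp :: "real^'n^'n \<Rightarrow> real^'n^'n" where
  "matrix_exp A = (\<Sum>k. (1 / fact k) *\<^sub>R matrix_power A k)"

(* Both descriptions below determine a unique matrix when the argument is in pos_def_matrices;
   elsewhere the value is irrelevant. *)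
definition matrix_log :: "real^'n^'n \<Rightarrow> real^'n^'n" where
  "matrix_log A = (THE X. transpose X = X \<and> matrix_exp X = A)"

definition matrix_sqrt :: "real^'n^'n \<Rightarrow> real^'n^'n" where
  "matrix_sqrt A = (THE X. X \<in> pos_def_matrices \<and> X ** X = A)"

definition riemannian_update ::
    "real \<Rightarrow> real^'n^'n \<Rightarrow> real^'n^'n \<Rightarrow> real^'n^'n" where
  "riemannian_update \<gamma> V W =
     (let S = matrix_sqrt V; R = matrix_inv S
      in S ** matrix_exp (\<gamma> *\<^sub>R matrix_log (R ** W ** R)) ** S)"

(* gossip s \<gamma> W0 t i is the value at node i and time t when node s k is picked at time k,
   the step sizes are \<gamma> k and the initial values are W0. *)
primrec gossip ::
    "(nat \<Rightarrow> nat) \<Rightarrow> (nat \<Rightarrow> real) \<Rightarrow> (nat \<Rightarrow> real^'n^'n) \<Rightarrow> nat \<Rightarrow> nat \<Rightarrow> real^'n^'n" where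
  "gossip s \<gamma> W0 0 = W0"
| "gossip s \<gamma> W0 (Suc t) =
     (let W = gossip s \<gamma> W0 t; i = s t
      in W(i := riemannian_update (\<gamma> t) (W i) (W (i + 1)),
           i + 1 := riemannian_update (\<gamma> t) (W (i + 1)) (W i)))"

end

theory Submission
  imports Defs
begin

text \<open>
  Congruence by \<open>G\<close> does not commute with the square root, but it does so up to a rotation. Let
  \<open>V\<close> and \<open>W\<close> be positive definite, let \<open>S\<close> and \<open>S'\<close> be the square roots of \<open>V\<close> and of
  \<open>G V G\<^sup>T\<close>, and put \<open>U = S'\<^sup>-\<^sup>1 G S\<close>. Then
  \<open>U U\<^sup>T = S'\<^sup>-\<^sup>1 (G V G\<^sup>T) S'\<^sup>-\<^sup>1 = 1\<close>, so \<open>U\<close> is orthogonal, and \<open>G S = S' U\<close>. Since moreover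
  \<open>S'\<^sup>-\<^sup>1 G = U S\<^sup>-\<^sup>1\<close>, the matrix whose logarithm enters the update of the transformed data is
  \<open>U (S\<^sup>-\<^sup>1 W S\<^sup>-\<^sup>1) U\<^sup>T\<close>. Exponential and logarithm commute with conjugation by an orthogonal
  matrix, hence the transformed update is \<open>S' U E U\<^sup>T S' = G S E S G\<^sup>T\<close>, where \<open>S E S\<close> is the original
  update. This is \<open>riemannian_update_congruence\<close>; the theorem follows by induction on time, along
  with the fact that updates stay positive definite.

  Square root and logarithm are defined by description, so their defining properties rest on
  existence and uniqueness, and both come from the spectral theorem
  (\<open>symmetric_matrix_eq_spectral\<close>). Existence: apply the scalar function to the eigenvalues.
  Uniqueness: a symmetric \<open>X\<close> can be recovered from any \<open>f(X)\<close> with \<open>f\<close> injective on the eigenvalues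
  (\<open>spectral_map_inj\<close>); this is used for squaring on the positive reals and for \<open>exp\<close>.
\<close>

section \<open>The spectral theorem for real symmetric matrices\<close>

text \<open>The first-order condition at a minimum: for small \<open>t\<close> of the sign opposite to \<open>b\<close>, the linear term
  outweighs the quadratic one.\<close>
lemma linear_coefficient_zero_if_quadratic_nonneg:
  fixes b c :: real
  assumes "\<And>t. 0 \<le> 2 * t * b + t\<^sup>2 * c"
  shows "b = 0"
proof (rule ccontr)
  assume b: "b \<noteq> 0"
  \<comment> \<open>This is the minimiser if \<open>c\<close> is enlarged to \<open>\<bar>c\<bar> + 1\<close>, which is never zero.\<close>
  define t where "t = - b / (\<bar>c\<bar> + 1)"
  have "2 * t * b + t\<^sup>2 * c \<le> 2 * t * b + t\<^sup>2 * (\<bar>c\<bar> + 1)"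
    by (intro add_left_mono mult_left_mono) auto
  also have "\<dots> = - (b\<^sup>2 / (\<bar>c\<bar> + 1))"
    by (simp add: t_def power2_eq_square divide_simps)
  also have "\<dots> < 0"
    using b by (simp add: divide_pos_pos)
  finally show False
    using assms[of t] by simp
qed

text \<open>Rayleigh's principle: the quadratic form of \<open>f\<close> attains its maximum over the compact unit sphere of
  the invariant subspace \<open>T\<close>, and a maximiser is an eigenvector whose eigenvalue is the maximum.\<close>
lemma self_adjoint_eigenvector_exists:
  fixes f :: "'a::euclidean_space \<Rightarrow> 'a"
  assumes f: "linear f" and adj: "\<And>x y. f x \<bullet> y = x \<bullet> f y"
    and T: "subspace T" and inv: "\<And>x. x \<in> T \<Longrightarrow> f x \<in> T"
    and z: "z \<in> T" "z \<noteq> 0"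
  obtains v l where "v \<in> T" "norm v = 1" "f v = l *\<^sub>R v"
proof -
  have "compact (T \<inter> sphere 0 1)"
    using T by (simp add: closed_Int_compact closed_subspace)
  moreover have "z /\<^sub>R norm z \<in> T \<inter> sphere 0 1"
    using T z by (simp add: subspace_scale)
  moreover have "continuous_on (T \<inter> sphere 0 1) (\<lambda>x. x \<bullet> f x)"
    by (intro continuous_intros linear_continuous_on linear_conv_bounded_linear[THEN iffD1] f)
  ultimately obtain v where "v \<in> T \<inter> sphere 0 1"
    and "\<forall>x\<in>T \<inter> sphere 0 1. x \<bullet> f x \<le> v \<bullet> f v"
    using continuous_attains_sup[of "T \<inter> sphere 0 1" "\<lambda>x. x \<bullet> f x"] by blast
  hence v: "v \<in> T" "norm v = 1"
    and max: "\<And>x. x \<in> T \<Longrightarrow> norm x = 1 \<Longrightarrow> x \<bullet> f x \<le> v \<bullet> f v"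
    by auto
  define l where "l = v \<bullet> f v"
  define g where "g x = l *\<^sub>R x - f x" for x
  have vv: "v \<bullet> v = 1"
    using v by (simp add: norm_eq_1)
  have g_nonneg: "0 \<le> x \<bullet> g x" if "x \<in> T" for x
  proof (cases "x = 0")
    case False
    have "(x /\<^sub>R norm x) \<bullet> f (x /\<^sub>R norm x) \<le> l"
      unfolding l_def using that T False by (intro max) (auto simp: subspace_scale)
    hence "x \<bullet> f x \<le> l * (norm x)\<^sup>2"
      using False by (simp add: linear_cmul[OF f] power2_eq_square divide_simps)
    thus ?thesis
      by (simp add: g_def inner_diff_right power2_norm_eq_inner)
  qed (simp add: g_def)
  have gT: "g x \<in> T" if "x \<in> T" for x
    using that T inv by (simp add: g_def subspace_diff subspace_scale)
  define w where "w = g v"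
  have wT: "w \<in> T"
    using gT v by (simp add: w_def)
  have v_gw: "v \<bullet> g w = w \<bullet> w"
  proof -
    have "v \<bullet> g w = g v \<bullet> w"
      using adj[of v w] by (simp add: g_def inner_diff_left inner_diff_right)
    thus ?thesis
      by (simp only: w_def)
  qed
  have v_gv: "v \<bullet> g v = 0"
    by (simp add: g_def l_def inner_diff_right vv)
  \<comment> \<open>On \<open>T\<close> the form of \<open>g\<close> is nonnegative, and it vanishes at \<open>v\<close>. Hence its first variation at \<open>v\<close>
    vanishes in every direction of \<open>T\<close>; the direction \<open>g v\<close> gives \<open>g v = 0\<close>.\<close>
  have "w \<bullet> w = 0"
  proof (rule linear_coefficient_zero_if_quadratic_nonneg)
    fix t
    have "0 \<le> (v + t *\<^sub>R w) \<bullet> g (v + t *\<^sub>R w)"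
      using T v wT by (intro g_nonneg) (simp add: subspace_add subspace_scale)
    also have "g (v + t *\<^sub>R w) = w + t *\<^sub>R g w"
      unfolding w_def by (simp add: g_def linear_add[OF f] linear_diff[OF f] linear_cmul[OF f] algebra_simps)
    also have "(v + t *\<^sub>R w) \<bullet> (w + t *\<^sub>R g w) = 2 * t * (w \<bullet> w) + t\<^sup>2 * (w \<bullet> g w)"
      using v_gw v_gv
      by (simp add: inner_add_left inner_add_right power2_eq_square algebra_simps
          flip: w_def)
    finally show "0 \<le> 2 * t * (w \<bullet> w) + t\<^sup>2 * (w \<bullet> g w)" .
  qed
  hence "f v = l *\<^sub>R v"
    by (simp add: w_def g_def)
  thus thesis
    using that v by blast
qed

text \<open>The orthogonal complement of a set of eigenvectors of a self-adjoint map is invariant. As long as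
  it is nonzero it contains a further eigenvector, so an orthonormal system of eigenvectors can be
  extended until it has as many members as the dimension.\<close>
lemma self_adjoint_orthonormal_eigenvectors:
  fixes f :: "'a::euclidean_space \<Rightarrow> 'a"
  assumes f: "linear f" and adj: "\<And>x y. f x \<bullet> y = x \<bullet> f y"
  shows "\<exists>B. finite B \<and> card B = DIM('a) \<and> pairwise orthogonal B
           \<and> (\<forall>b\<in>B. norm b = 1 \<and> (\<exists>l. f b = l *\<^sub>R b))"
proof -
  have "\<exists>B. finite B \<and> card B = k \<and> pairwise orthogonal B
          \<and> (\<forall>b\<in>B. norm b = 1 \<and> (\<exists>l. f b = l *\<^sub>R b))" if "k \<le> DIM('a)" for k
    using that
  proof (induction k)
    case 0
    show ?case
      by (intro exI[of _ "{}"]) auto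
  next
    case (Suc k)
    then obtain B where B: "finite B" "card B = k" "pairwise orthogonal B"
      and eig: "\<And>b. b \<in> B \<Longrightarrow> norm b = 1 \<and> (\<exists>l. f b = l *\<^sub>R b)"
      by auto
    define T where "T = {x. \<forall>b\<in>B. orthogonal b x}"
    have "dim (span B) < DIM('a)"
      using dim_le_card[of B B] B Suc.prems by (simp add: span_superset)
    then obtain z where z: "z \<noteq> 0" "\<And>y. y \<in> span B \<Longrightarrow> orthogonal z y"
      using orthogonal_to_subspace_exists[of "span B"] by (metis dim_span span_span)
    have "subspace T"
      by (auto simp: T_def subspace_def orthogonal_clauses)
    moreover have "f x \<in> T" if "x \<in> T" for x
      unfolding T_def
    proof (intro CollectI ballI)
      fix b assume b: "b \<in> B"
      then obtain l where "f b = l *\<^sub>R b"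
        using eig by blast
      thus "orthogonal b (f x)"
        using adj[of b x] that b by (auto simp: T_def orthogonal_def)
    qed
    moreover have "z \<in> T"
      using z(2) by (auto simp: T_def orthogonal_commute span_base)
    ultimately obtain v l where v: "v \<in> T" "norm v = 1" "f v = l *\<^sub>R v"
      using self_adjoint_eigenvector_exists[OF f adj] z(1) by blast
    have "v \<notin> B"
      using v by (force simp: T_def orthogonal_def)
    moreover have "pairwise orthogonal (insert v B)"
      using B(3) v(1) by (auto simp: pairwise_insert T_def orthogonal_commute)
    ultimately show ?case
      using B eig v by (intro exI[of _ "insert v B"]) auto
  qed
  thus ?thesis
    by blast
qed

definition diagonal :: "real^'n \<Rightarrow> real^'n^'n" where
  "diagonal d = (\<chi> i j. if i = j then d $ i else 0)"

text \<open>The eigenvalues are kept as a vector because vectors multiply componentwise: for a fixed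
  orthogonal \<open>Q\<close>, the map \<open>spectral Q\<close> is then an algebra homomorphism.\<close>
definition spectral :: "real^'n^'n \<Rightarrow> real^'n \<Rightarrow> real^'n^'n" where
  "spectral Q d = Q ** diagonal d ** transpose Q"

lemma matrix_mult_diagonal_nth: "(A ** diagonal d) $ i $ j = A $ i $ j * d $ j"
  by (simp add: matrix_matrix_mult_def diagonal_def if_distrib cong: if_cong)

lemma diagonal_mult_matrix_nth: "(diagonal d ** A) $ i $ j = d $ i * A $ i $ j"
  by (simp add: matrix_matrix_mult_def diagonal_def if_distrib[of "\<lambda>x. x * _"] cong: if_cong)

text \<open>The columns of \<open>Q\<close> form an orthonormal basis of eigenvectors, so that \<open>A Q = Q D\<close> with \<open>D\<close> the
  diagonal matrix of eigenvalues.\<close>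
lemma symmetric_matrix_eq_spectral:
  fixes A :: "real^'n^'n"
  assumes "transpose A = A"
  obtains Q d where "orthogonal_matrix Q" "A = spectral Q d"
proof -
  have "(A *v x) \<bullet> y = x \<bullet> (A *v y)" for x y
    using assms by (metis dot_lmul_matrix vector_transpose_matrix)
  then obtain B where B: "finite B" "card B = CARD('n)" "pairwise orthogonal B"
    and eig: "\<And>b. b \<in> B \<Longrightarrow> norm b = 1 \<and> (\<exists>l. A *v b = l *\<^sub>R b)"
    using self_adjoint_orthonormal_eigenvectors[of "(*v) A"] by auto
  obtain h where h: "bij_betw h (UNIV :: 'n set) B"
    using finite_same_card_bij[of "UNIV :: 'n set" B] B by auto
  hence hB: "h i \<in> B" for i
    by (auto simp: bij_betw_def)
  have h_orth: "orthogonal (h i) (h j)" if "i \<noteq> j" for i j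
    using that h hB B(3) by (metis UNIV_I bij_betw_def inj_on_def pairwise_def)
  have "\<forall>i. \<exists>l. A *v h i = l *\<^sub>R h i"
    using eig hB by blast
  then obtain l where l: "\<And>i. A *v h i = l i *\<^sub>R h i"
    unfolding choice_iff by blast
  define Q :: "real^'n^'n" where "Q = (\<chi> i j. h j $ i)"
  have col: "column j Q = h j" for j
    by (simp add: Q_def column_def)
  have Q: "orthogonal_matrix Q"
    using eig hB h_orth by (simp add: orthogonal_matrix_orthonormal_columns col)
  have "(A ** Q) $ i $ j = (Q ** diagonal (vec_lambda l)) $ i $ j" for i j
  proof -
    have "(A ** Q) $ i $ j = (A *v h j) $ i"
      by (simp add: matrix_matrix_mult_def matrix_vector_mult_def Q_def)
    thus ?thesis
      by (simp add: l matrix_mult_diagonal_nth Q_def)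
  qed
  hence "A ** Q = Q ** diagonal (vec_lambda l)"
    by (simp add: vec_eq_iff)
  hence "spectral Q (vec_lambda l) = A ** (Q ** transpose Q)"
    by (simp add: spectral_def matrix_mul_assoc)
  hence "A = spectral Q (vec_lambda l)"
    using Q by (simp add: orthogonal_matrix_def)
  with Q that show thesis
    by blast
qed

section \<open>Calculus with spectral decompositions\<close>

lemma transpose_spectral: "transpose (spectral Q d) = spectral Q d"
proof -
  have "transpose (diagonal d) = diagonal d"
    by (auto simp: diagonal_def transpose_def vec_eq_iff)
  thus ?thesis
    by (simp add: spectral_def matrix_transpose_mul matrix_mul_assoc)
qed

lemma spectral_mult:
  assumes "orthogonal_matrix Q"
  shows "spectral Q d ** spectral Q e = spectral Q (d * e)"
proof -
  have "diagonal d ** diagonal e = diagonal (d * e)"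
    by (simp add: vec_eq_iff diagonal_mult_matrix_nth) (simp add: diagonal_def)
  hence "spectral Q (d * e)
           = Q ** diagonal d ** (transpose Q ** Q) ** diagonal e ** transpose Q"
    using assms by (simp add: spectral_def orthogonal_matrix_def flip: matrix_mul_assoc)
  thus ?thesis
    by (simp only: spectral_def matrix_mul_assoc)
qed

lemma spectral_one:
  fixes Q :: "real^'n^'n"
  assumes "orthogonal_matrix Q"
  shows "spectral Q 1 = mat 1"
proof -
  have "diagonal 1 = (mat 1 :: real^'n^'n)"
    by (simp add: vec_eq_iff diagonal_def mat_def)
  thus ?thesis
    using assms by (simp add: spectral_def orthogonal_matrix_def)
qed

lemma spectral_linear: "linear (spectral Q)"
proof -
  have "spectral Q d $ i $ j = (\<Sum>k\<in>UNIV. (Q ** diagonal d) $ i $ k * Q $ j $ k)" for d i j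
    unfolding spectral_def by (subst matrix_matrix_mult_def) (simp add: transpose_def)
  hence "spectral Q d $ i $ j = (\<Sum>k\<in>UNIV. Q $ i $ k * d $ k * Q $ j $ k)" for d i j
    by (simp add: matrix_mult_diagonal_nth)
  thus ?thesis
    by (intro linearI)
      (simp_all add: vec_eq_iff algebra_simps sum.distrib sum_distrib_left)
qed

lemma conjugate_spectral: "U ** spectral Q d ** transpose U = spectral (U ** Q) d"
  by (simp add: spectral_def matrix_transpose_mul matrix_mul_assoc)

lemma spectral_quadratic_form:
  "x \<bullet> (spectral Q d *v x) = (\<Sum>i\<in>UNIV. d $ i * ((transpose Q *v x) $ i)\<^sup>2)"
proof -
  have "(diagonal d *v y) $ i = d $ i * y $ i" for y i
    by (simp add: matrix_vector_mult_def diagonal_def if_distrib[of "\<lambda>x. x * _"] cong: if_cong)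
  hence diag: "y \<bullet> (diagonal d *v y) = (\<Sum>i\<in>UNIV. d $ i * (y $ i)\<^sup>2)" for y
    by (simp add: inner_vec_def power2_eq_square mult_ac)
  have "spectral Q d *v x = Q *v (diagonal d *v (transpose Q *v x))"
    by (simp add: spectral_def matrix_vector_mul_assoc matrix_mul_assoc del: transpose_matrix_vector)
  hence "x \<bullet> (spectral Q d *v x)
           = (transpose Q *v x) \<bullet> (diagonal d *v (transpose Q *v x))"
    by (simp add: dot_lmul_matrix)
  thus ?thesis
    by (simp only: diag)
qed

lemma spectral_pos_def_iff:
  assumes Q: "orthogonal_matrix Q"
  shows "spectral Q d \<in> pos_def_matrices \<longleftrightarrow> (\<forall>i. d $ i > 0)"
proof
  assume pd: "spectral Q d \<in> pos_def_matrices"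
  show "\<forall>i. d $ i > 0"
  proof
    fix i
    have y: "transpose Q *v (Q *v axis i 1) = axis i 1"
      using Q by (simp add: matrix_vector_mul_assoc orthogonal_matrix_def)
    hence "Q *v axis i 1 \<noteq> 0"
      by (metis axis_eq_0_iff matrix_vector_mult_0_right zero_neq_one)
    hence "0 < (Q *v axis i 1) \<bullet> (spectral Q d *v (Q *v axis i 1))"
      using pd by (simp add: pos_def_matrices_def)
    also have "\<dots> = (\<Sum>k\<in>UNIV. d $ k * (axis i 1 $ k)\<^sup>2)"
      by (simp only: spectral_quadratic_form y)
    also have "\<dots> = d $ i"
      by (simp add: axis_def if_distrib[of "\<lambda>x. x\<^sup>2"] if_distrib[of "\<lambda>x. _ * x"] cong: if_cong)
    finally show "d $ i > 0" .
  qed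
next
  assume d: "\<forall>i. d $ i > 0"
  have "x \<bullet> (spectral Q d *v x) > 0" if "x \<noteq> 0" for x
  proof -
    have "transpose Q *v x \<noteq> 0"
      using that Q by (metis matrix_vector_mul_assoc matrix_vector_mul_lid
          matrix_vector_mult_0_right orthogonal_matrix_def)
    then obtain i where "(transpose Q *v x) $ i \<noteq> 0"
      by (auto simp: vec_eq_iff)
    thus ?thesis
      unfolding spectral_quadratic_form using d
      by (intro sum_pos2[of _ i]) (simp_all add: less_imp_le)
  qed
  thus "spectral Q d \<in> pos_def_matrices"
    by (simp add: pos_def_matrices_def transpose_spectral)
qed

lemma pos_def_eq_spectral:
  assumes "A \<in> pos_def_matrices"
  obtains Q d where "orthogonal_matrix Q" "A = spectral Q d" "\<And>i. d $ i > 0"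
proof -
  obtain Q d where Q: "orthogonal_matrix Q" "A = spectral Q d"
    using assms symmetric_matrix_eq_spectral[of A] by (auto simp: pos_def_matrices_def)
  with assms have "d $ i > 0" for i
    by (simp add: spectral_pos_def_iff)
  with Q that show thesis
    by blast
qed

text \<open>If \<open>X = P D P\<^sup>T\<close> and \<open>Y = Q E Q\<^sup>T\<close> satisfy \<open>f(X) = f(Y)\<close>, then \<open>U = Q\<^sup>T P\<close> intertwines \<open>f(D)\<close> and
  \<open>f(E)\<close>. Entrywise this says that \<open>U $ i $ j\<close> can be nonzero only where \<open>f (d $ j) = f (e $ i)\<close>, that is,
  where \<open>d $ j = e $ i\<close>; therefore \<open>U\<close> intertwines \<open>D\<close> and \<open>E\<close> too.\<close>
lemma spectral_map_inj:
  assumes P: "orthogonal_matrix P" and Q: "orthogonal_matrix Q"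
    and eq: "spectral P (\<chi> i. f (d $ i)) = spectral Q (\<chi> i. f (e $ i))"
    and inj: "inj_on f S" and d: "\<And>i. d $ i \<in> S" and e: "\<And>i. e $ i \<in> S"
  shows "spectral P d = spectral Q e"
proof -
  define U where "U = transpose Q ** P"
  have UP: "U ** transpose P = transpose Q"
    using P by (simp add: U_def orthogonal_matrix_def flip: matrix_mul_assoc)
  have QU: "Q ** U = P"
    using Q by (simp add: U_def matrix_mul_assoc orthogonal_matrix_def)
  let ?fd = "diagonal (\<chi> i. f (d $ i))" and ?fe = "diagonal (\<chi> i. f (e $ i))"
  have "U ** ?fd = transpose Q ** P ** ?fd ** (transpose P ** P)"
    using P by (simp add: U_def orthogonal_matrix_def)
  also have "\<dots> = transpose Q ** spectral P (\<chi> i. f (d $ i)) ** P"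
    by (simp only: spectral_def matrix_mul_assoc)
  also have "\<dots> = (transpose Q ** Q) ** ?fe ** (transpose Q ** P)"
    unfolding eq by (simp only: spectral_def matrix_mul_assoc)
  also have "\<dots> = ?fe ** U"
    using Q by (simp add: U_def orthogonal_matrix_def)
  finally have comm: "U ** ?fd = ?fe ** U" .
  have "U $ i $ j * d $ j = e $ i * U $ i $ j" for i j
  proof -
    have "U $ i $ j * f (d $ j) = f (e $ i) * U $ i $ j"
      using arg_cong[OF comm, of "\<lambda>M. M $ i $ j"]
      by (simp add: matrix_mult_diagonal_nth diagonal_mult_matrix_nth)
    hence "U $ i $ j = 0 \<or> d $ j = e $ i"
      using inj_onD[OF inj _ d e] by auto
    thus ?thesis
      by auto
  qed
  hence comm': "U ** diagonal d = diagonal e ** U"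
    by (simp add: vec_eq_iff matrix_mult_diagonal_nth diagonal_mult_matrix_nth)
  have "spectral P d = Q ** (U ** diagonal d) ** transpose P"
    by (simp only: spectral_def matrix_mul_assoc QU)
  also have "\<dots> = Q ** diagonal e ** (U ** transpose P)"
    by (simp only: comm' matrix_mul_assoc)
  finally show ?thesis
    by (simp only: UP spectral_def)
qed

section \<open>Square root, exponential and logarithm\<close>

lemma matrix_sqrt_unique:
  assumes X: "X \<in> pos_def_matrices" and Y: "Y \<in> pos_def_matrices"
    and eq: "X ** X = Y ** Y"
  shows "X = Y"
proof -
  obtain P d where P: "orthogonal_matrix P" "X = spectral P d" "\<And>i. d $ i > 0"
    using pos_def_eq_spectral X by blast
  obtain Q e where Q: "orthogonal_matrix Q" "Y = spectral Q e" "\<And>i. e $ i > 0"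
    using pos_def_eq_spectral Y by blast
  have sq: "x * x = (\<chi> i. (x $ i)\<^sup>2)" for x :: "real^'n"
    by (simp add: vec_eq_iff power2_eq_square)
  have "inj_on (\<lambda>x::real. x\<^sup>2) {0<..}"
    by (auto simp: inj_on_def power2_eq_iff)
  thus ?thesis
    using spectral_map_inj[OF P(1) Q(1), of "\<lambda>x. x\<^sup>2" d e "{0<..}"] eq P Q
    by (simp add: spectral_mult sq)
qed

lemma matrix_sqrt:
  assumes "A \<in> pos_def_matrices"
  shows "matrix_sqrt A \<in> pos_def_matrices" "matrix_sqrt A ** matrix_sqrt A = A"
proof -
  obtain Q d where Q: "orthogonal_matrix Q" "A = spectral Q d" "\<And>i. d $ i > 0"
    using pos_def_eq_spectral assms by blast
  let ?X = "spectral Q (\<chi> i. sqrt (d $ i))"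
  have "(\<chi> i. sqrt (d $ i)) * (\<chi> i. sqrt (d $ i)) = d"
    using Q(3) by (simp add: vec_eq_iff less_imp_le)
  hence "?X \<in> pos_def_matrices \<and> ?X ** ?X = A"
    using Q by (simp add: spectral_mult spectral_pos_def_iff)
  hence "\<exists>!X. X \<in> pos_def_matrices \<and> X ** X = A"
    using matrix_sqrt_unique by (intro ex1I[of _ ?X]) blast+
  from theI'[OF this]
  show "matrix_sqrt A \<in> pos_def_matrices" "matrix_sqrt A ** matrix_sqrt A = A"
    unfolding matrix_sqrt_def by blast+
qed

text \<open>The powers of \<open>spectral Q d\<close> are \<open>spectral Q\<close> of the componentwise powers, and \<open>spectral Q\<close> is
  linear, hence continuous, so it can be interchanged with the scalar exponential series.\<close>
lemma matrix_exp_spectral: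
  fixes Q :: "real^'n^'n"
  assumes Q: "orthogonal_matrix Q"
  shows "matrix_exp (spectral Q d) = spectral Q (\<chi> i. exp (d $ i))"
proof -
  have pow: "matrix_power (spectral Q d) k = spectral Q (\<chi> i. d $ i ^ k)" for k
  proof (induction k)
    case 0
    have "(\<chi> i. d $ i ^ 0) = (1 :: real^'n)"
      by (simp add: vec_eq_iff)
    thus ?case
      using spectral_one[OF Q] by simp
  next
    case (Suc k)
    have "d * (\<chi> i. d $ i ^ k) = (\<chi> i. d $ i ^ Suc k)"
      by (simp add: vec_eq_iff)
    thus ?case
      by (simp add: Suc spectral_mult[OF Q])
  qed
  have "(\<lambda>k. (1 / fact k) *\<^sub>R (\<chi> i. d $ i ^ k)) sums (\<chi> i. exp (d $ i))"
    unfolding sums_def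
  proof (rule vec_tendstoI)
    fix i
    show "(\<lambda>n. (\<Sum>k<n. (1 / fact k) *\<^sub>R (\<chi> i. d $ i ^ k)) $ i)
            \<longlonglongrightarrow> (\<chi> i. exp (d $ i)) $ i"
      using exp_converges[of "d $ i"] by (simp add: sums_def divide_inverse)
  qed
  hence "(\<lambda>k. spectral Q ((1 / fact k) *\<^sub>R (\<chi> i. d $ i ^ k))) sums spectral Q (\<chi> i. exp (d $ i))"
    by (rule bounded_linear.sums[OF linear_conv_bounded_linear[THEN iffD1, OF spectral_linear]])
  thus ?thesis
    unfolding matrix_exp_def pow linear_cmul[OF spectral_linear] by (rule sums_unique[symmetric])
qed

lemma matrix_exp_pos_def:
  assumes "transpose X = X"
  shows "matrix_exp X \<in> pos_def_matrices"
proof -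
  obtain Q d where "orthogonal_matrix Q" "X = spectral Q d"
    using symmetric_matrix_eq_spectral assms by blast
  thus ?thesis
    by (simp add: matrix_exp_spectral spectral_pos_def_iff)
qed

lemma matrix_exp_conjugate:
  assumes U: "orthogonal_matrix U" and "transpose X = X"
  shows "matrix_exp (U ** X ** transpose U) = U ** matrix_exp X ** transpose U"
proof -
  obtain Q d where "orthogonal_matrix Q" "X = spectral Q d"
    using symmetric_matrix_eq_spectral assms(2) by blast
  thus ?thesis
    using orthogonal_matrix_mul[OF U] by (simp add: conjugate_spectral matrix_exp_spectral)
qed

lemma matrix_log_unique:
  assumes X: "transpose X = X" and Y: "transpose Y = Y"
    and eq: "matrix_exp X = matrix_exp Y"
  shows "X = Y"
proof -
  obtain P d where P: "orthogonal_matrix P" "X = spectral P d"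
    using symmetric_matrix_eq_spectral X by blast
  obtain Q e where Q: "orthogonal_matrix Q" "Y = spectral Q e"
    using symmetric_matrix_eq_spectral Y by blast
  have "inj_on (exp :: real \<Rightarrow> real) UNIV"
    by (simp add: inj_on_def)
  thus ?thesis
    using spectral_map_inj[OF P(1) Q(1), of exp d e UNIV] eq P Q
    by (simp add: matrix_exp_spectral)
qed

lemma matrix_log_eqI:
  assumes "transpose X = X" "matrix_exp X = A"
  shows "matrix_log A = X"
  unfolding matrix_log_def using assms matrix_log_unique by (intro the_equality) auto

lemma matrix_log:
  assumes "A \<in> pos_def_matrices"
  shows "transpose (matrix_log A) = matrix_log A" "matrix_exp (matrix_log A) = A"
proof -
  obtain Q d where Q: "orthogonal_matrix Q" "A = spectral Q d" "\<And>i. d $ i > 0"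
    using pos_def_eq_spectral assms by blast
  let ?X = "spectral Q (\<chi> i. ln (d $ i))"
  have "matrix_exp ?X = A"
    using Q by (simp add: matrix_exp_spectral)
  moreover from this have "matrix_log A = ?X"
    by (intro matrix_log_eqI transpose_spectral)
  ultimately show "transpose (matrix_log A) = matrix_log A" "matrix_exp (matrix_log A) = A"
    by (simp_all add: transpose_spectral)
qed

lemma matrix_log_conjugate:
  assumes U: "orthogonal_matrix U" and A: "A \<in> pos_def_matrices"
  shows "matrix_log (U ** A ** transpose U) = U ** matrix_log A ** transpose U"
  using matrix_log[OF A] matrix_exp_conjugate[OF U]
  by (intro matrix_log_eqI) (simp_all add: matrix_transpose_mul matrix_mul_assoc)

section \<open>Congruence and the algorithm\<close>

lemma pos_def_congruence:
  fixes G W :: "real^'n^'n"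
  assumes G: "invertible G" and W: "W \<in> pos_def_matrices"
  shows "G ** W ** transpose G \<in> pos_def_matrices"
proof -
  have "x \<bullet> (G ** W ** transpose G *v x) > 0" if "x \<noteq> 0" for x
  proof -
    let ?y = "transpose G *v x"
    have "?y \<noteq> 0"
      using that transpose_invertible[OF G] by (metis invertible_def matrix_left_invertible_ker)
    hence "0 < ?y \<bullet> (W *v ?y)"
      using W by (simp add: pos_def_matrices_def)
    also have "\<dots> = x \<bullet> (G *v (W *v ?y))"
      by (simp add: dot_lmul_matrix)
    also have "\<dots> = x \<bullet> (G ** W ** transpose G *v x)"
      by (simp add: matrix_vector_mul_assoc matrix_mul_assoc del: transpose_matrix_vector)
    finally show ?thesis .
  qed
  thus ?thesis
    using W by (simp add: pos_def_matrices_def matrix_transpose_mul matrix_mul_assoc)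
qed

lemma pos_def_invertible:
  assumes "A \<in> pos_def_matrices"
  shows "invertible A"
proof -
  have "\<forall>x. A *v x = 0 \<longrightarrow> x = 0"
    using assms by (force simp: pos_def_matrices_def)
  thus ?thesis
    by (metis invertible_left_inverse matrix_left_invertible_ker)
qed

lemma pos_def_matrix_inv:
  fixes A :: "real^'n^'n"
  assumes "A \<in> pos_def_matrices"
  shows "A ** matrix_inv A = mat 1" "matrix_inv A ** A = mat 1"
    "transpose (matrix_inv A) = matrix_inv A" "invertible (matrix_inv A)"
proof -
  show 1: "A ** matrix_inv A = mat 1" "matrix_inv A ** A = mat 1"
    using pos_def_invertible[OF assms] unfolding invertible_def matrix_inv_def
    by (metis (mono_tags, lifting) someI_ex)+
  thus "invertible (matrix_inv A)"
    unfolding invertible_def by blast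
  have "transpose (matrix_inv A) ** A = mat 1"
    using arg_cong[OF 1(1), of transpose] assms
    by (simp add: matrix_transpose_mul pos_def_matrices_def)
  thus "transpose (matrix_inv A) = matrix_inv A"
    using matrix_mul_assoc[of "transpose (matrix_inv A)" A "matrix_inv A"] 1(1) by simp
qed

lemma pos_def_symmetric: "A \<in> pos_def_matrices \<Longrightarrow> transpose A = A"
  by (simp add: pos_def_matrices_def)

text \<open>This puts the argument of the logarithm in an update into the range where \<open>matrix_log\<close> inverts
  \<open>matrix_exp\<close>.\<close>
lemma whitened_pos_def:
  assumes "V \<in> pos_def_matrices" "W \<in> pos_def_matrices"
  shows "matrix_inv (matrix_sqrt V) ** W ** matrix_inv (matrix_sqrt V) \<in> pos_def_matrices"
  using pos_def_matrix_inv(3,4)[OF matrix_sqrt(1)[OF assms(1)]] pos_def_congruence assms(2)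
  by metis

lemma riemannian_update_pos_def:
  assumes V: "V \<in> pos_def_matrices" and W: "W \<in> pos_def_matrices"
  shows "riemannian_update \<gamma> V W \<in> pos_def_matrices"
proof -
  let ?S = "matrix_sqrt V"
  let ?L = "matrix_log (matrix_inv ?S ** W ** matrix_inv ?S)"
  have "transpose (\<gamma> *\<^sub>R ?L) = \<gamma> *\<^sub>R ?L"
    using matrix_log(1)[OF whitened_pos_def[OF V W]] by (simp add: transpose_scalar)
  hence "?S ** matrix_exp (\<gamma> *\<^sub>R ?L) ** transpose ?S \<in> pos_def_matrices"
    by (intro pos_def_congruence matrix_exp_pos_def pos_def_invertible matrix_sqrt V)
  thus ?thesis
    using pos_def_symmetric[OF matrix_sqrt(1)[OF V]] by (simp add: riemannian_update_def Let_def)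
qed

text \<open>The matrix \<open>U = S'\<^sup>-\<^sup>1 G S\<close> measures by how much congruence by \<open>G\<close> fails to commute with taking square
  roots. It is orthogonal, thus it passes through logarithm and exponential, and the outer factors
  \<open>S'\<close> turn it back into \<open>G\<close>.\<close>
lemma riemannian_update_congruence:
  fixes G V W :: "real^'n^'n"
  assumes G: "invertible G" and V: "V \<in> pos_def_matrices" and W: "W \<in> pos_def_matrices"
  shows "riemannian_update \<gamma> (G ** V ** transpose G) (G ** W ** transpose G)
           = G ** riemannian_update \<gamma> V W ** transpose G"
proof -
  define S where "S = matrix_sqrt V"
  define S' where "S' = matrix_sqrt (G ** V ** transpose G)"
  define R where "R = matrix_inv S"
  define R' where "R' = matrix_inv S'"
  define A where "A = R ** W ** R"
  define U where "U = R' ** G ** S"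
  have S: "S \<in> pos_def_matrices" "S ** S = V"
    using matrix_sqrt[OF V] by (simp_all add: S_def)
  have S': "S' \<in> pos_def_matrices" "S' ** S' = G ** V ** transpose G"
    using matrix_sqrt[OF pos_def_congruence[OF G V]] by (simp_all add: S'_def)
  note R = pos_def_matrix_inv[OF S(1), folded R_def]
  note R' = pos_def_matrix_inv[OF S'(1), folded R'_def]
  note sym = pos_def_symmetric[OF S(1)] pos_def_symmetric[OF S'(1)]
  have UT: "transpose U = S ** transpose G ** R'"
    by (simp add: U_def matrix_transpose_mul R' sym matrix_mul_assoc)
  have "U ** transpose U = R' ** (G ** (S ** S) ** transpose G) ** R'"
    by (simp only: UT) (simp add: U_def matrix_mul_assoc)
  also have "\<dots> = (R' ** S') ** (S' ** R')"
    unfolding S(2) S'(2)[symmetric] by (simp add: matrix_mul_assoc)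
  finally have "U ** transpose U = mat 1"
    using R' by simp
  hence U: "orthogonal_matrix U"
    by (simp add: orthogonal_matrix_def matrix_left_right_inverse)
  have UR: "U ** R = R' ** G"
    using R(1) by (simp add: U_def flip: matrix_mul_assoc)
  have RU: "R ** transpose U = transpose G ** R'"
    using arg_cong[OF UR, of transpose] by (simp add: matrix_transpose_mul R R')
  have SU: "S' ** U = G ** S"
    using R'(1) by (simp add: U_def matrix_mul_assoc)
  have US: "transpose U ** S' = S ** transpose G"
    using arg_cong[OF SU, of transpose] by (simp add: matrix_transpose_mul sym)
  have A: "A \<in> pos_def_matrices"
    unfolding A_def R_def S_def using V W by (rule whitened_pos_def)
  have L: "transpose (\<gamma> *\<^sub>R matrix_log A) = \<gamma> *\<^sub>R matrix_log A"
    using matrix_log(1)[OF A] by (simp add: transpose_scalar)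
  have "R' ** (G ** W ** transpose G) ** R' = (U ** R) ** W ** (R ** transpose U)"
    by (simp add: UR RU matrix_mul_assoc)
  also have "\<dots> = U ** A ** transpose U"
    by (simp add: A_def matrix_mul_assoc)
  finally have "\<gamma> *\<^sub>R matrix_log (R' ** (G ** W ** transpose G) ** R')
                  = U ** (\<gamma> *\<^sub>R matrix_log A) ** transpose U"
    using matrix_log_conjugate[OF U A]
    by (simp add: matrix_scalar_ac flip: scalar_matrix_assoc)
  hence "riemannian_update \<gamma> (G ** V ** transpose G) (G ** W ** transpose G)
           = S' ** (U ** matrix_exp (\<gamma> *\<^sub>R matrix_log A) ** transpose U) ** S'"
    by (simp add: riemannian_update_def Let_def matrix_exp_conjugate[OF U L]
        flip: S'_def R'_def)
  also have "\<dots> = (S' ** U) ** matrix_exp (\<gamma> *\<^sub>R matrix_log A) ** (transpose U ** S')"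
    by (simp add: matrix_mul_assoc)
  also have "\<dots> = G ** (S ** matrix_exp (\<gamma> *\<^sub>R matrix_log A) ** S) ** transpose G"
    by (simp add: SU US matrix_mul_assoc)
  also have "\<dots> = G ** riemannian_update \<gamma> V W ** transpose G"
    by (simp add: riemannian_update_def Let_def A_def flip: S_def R_def)
  finally show ?thesis .
qed

text \<open>Positive definiteness is carried through the induction because the equivariance of the update
  presupposes it. The range of \<open>s\<close> ensures that both nodes of an update carry such values.\<close>
lemma gossip_congruence:
  fixes G :: "real^'n^'n"
  assumes s: "\<And>t. s t \<in> {1..m-1}" and G: "invertible G"
    and W: "\<And>i. i \<in> {1..m} \<Longrightarrow> W i \<in> pos_def_matrices"
  shows "\<forall>i\<in>{1..m}. gossip s \<gamma> W t i \<in> pos_def_matrices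
           \<and> gossip s \<gamma> (\<lambda>j. G ** W j ** transpose G) t i
               = G ** gossip s \<gamma> W t i ** transpose G"
proof (induction t)
  case 0
  thus ?case
    using W by simp
next
  case (Suc t)
  have "s t \<in> {1..m}" "s t + 1 \<in> {1..m}"
    using s[of t] by auto
  with Suc show ?case
    by (auto simp: Let_def riemannian_update_pos_def riemannian_update_congruence[OF G])
qed

theorem proposition6:
  fixes m :: nat and p :: "nat \<Rightarrow> real"
    and M :: "'w measure" and I :: "nat \<Rightarrow> 'w \<Rightarrow> nat"
    and \<gamma> :: "nat \<Rightarrow> real"
    and G :: "real^'n^'n" and W0 :: "nat \<Rightarrow> real^'n^'n"
  assumes "\<And>i. i \<in> {1..m-1} \<Longrightarrow> p i > 0"
    and "(\<Sum>i=1..m-1. p i) = 1"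
    and "prob_space M"
    and "\<And>t. I t \<in> measurable M (count_space {1..m-1})"
    and "\<And>t i. i \<in> {1..m-1} \<Longrightarrow> measure M {\<omega> \<in> space M. I t \<omega> = i} = p i"
    and "\<And>t. \<gamma> t > 0"
    and "invertible G"
    and "\<And>i. i \<in> {1..m} \<Longrightarrow> W0 i \<in> pos_def_matrices"
  shows "\<forall>\<omega>\<in>space M. \<forall>t. \<forall>i\<in>{1..m}.
           gossip (\<lambda>k. I k \<omega>) \<gamma> (\<lambda>j. G ** W0 j ** transpose G) t i
             = G ** gossip (\<lambda>k. I k \<omega>) \<gamma> W0 t i ** transpose G"
proof (intro ballI allI)
  fix \<omega> t i
  assume "\<omega> \<in> space M" and i: "i \<in> {1..m}"
  hence "I k \<omega> \<in> {1..m-1}" for k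
    using measurable_space[OF assms(4)] by fastforce
  from gossip_congruence[where s = "\<lambda>k. I k \<omega>" and m = m and W = W0, OF this assms(7,8)] i
  show "gossip (\<lambda>k. I k \<omega>) \<gamma> (\<lambda>j. G ** W0 j ** transpose G) t i
          = G ** gossip (\<lambda>k. I k \<omega>) \<gamma> W0 t i ** transpose G"
    by blast
qed

end
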